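(* For $t\in\mathbb R$ let $|t|_{\mathbb Z}=\operatorname{dist}(t,\mathbb Z)$ denote the distance from $t$ to the closest integer. Let $\theta\in\mathbb R\setminus\mathbb Q$. Then, for each $\gamma\in\mathbb R$, the sum of the convergent power series $$g_\gamma^+(z)=\sum_{n\ge0}|\gamma+n\theta|_{\mathbb Z}\,z^n,\qquad z\in\mathbb D,$$ is an inner Poincaré simple pole series, thus uniquely rrl-continuable, with rrl-continuation given by $$g_\gamma^-(z)=-\sum_{n<0}|\gamma+n\theta|_{\mathbb Z}\,z^n=-g_{-\gamma}^+(z^{-1})+|\gamma|_{\mathbb Z},\qquad z\in\mathbb E,$$ and the unit circle is a strong natural boundary for $g_\gamma^+$.
   Context: Notation: $\mathbb D=\{z\in\mathbb C: |z|<1\}$, $\mathbb E=\{z\in\mathbb C:|z|>1\}\cup\{\infty\}\subset\widehat{\mathbb C}$, $\mathbb S=\{z\in\mathbb C:|z|=1\}$. Inner PSP-series: a holomorphic function on $\mathbb D$ of the form $z\mapsto\sum_{\lambda\in\mathbb S}\frac{\rho(\lambda)}{z-\lambda}$, where $\rho\colon\mathbb S\to\mathbb C$ satisfies $\sum_{\lambda\in\mathbb S}|\rho(\lambda)|<\infty$. Right limits: a right limit of a bounded sequence $(a_k)_{k\ge0}$ of complex numbers is a two-sided sequence $(b_n)_{n\in\mathbb Z}$ for which there is a strictly increasing sequence of positive integers $(k_j)_{j\ge1}$ with $\lim_{j\to\infty}a_{n+k_j}=b_n$ for every $n\in\mathbb Z$. It is renascent if $b_n=a_n$ for all $n\ge0$.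 rrl-continuation: a holomorphic function $g(z)=\sum_{k\ge0}a_kz^k$ on $\mathbb D$ with bounded $(a_k)$ is rrl-continuable if $(a_k)$ has a renascent right limit $(b_n)_{n\in\mathbb Z}$; then the function $z\mapsto-\sum_{n<0}b_nz^n$ on $\mathbb E$ is called an rrl-continuation of $g$. It is uniquely rrl-continuable if it has exactly one rrl-continuation. Strong natural boundary: the unit circle is a strong natural boundary for a holomorphic function $g$ on $\mathbb D$ if, for every nonempty open interval $(\omega_1,\omega_2)$, $\sup_{0<r<1}\int_{\omega_1}^{\omega_2}|g(re^{i\omega})|\,d\omega=\infty$. *)

theory Defs
  imports "HOL-Analysis.Analysis"
begin

definition dist_Z :: "real \<Rightarrow> real"
  where "dist_Z t = infdist t \<int>"

definition inner_PSP_series :: "(complex \<Rightarrow> complex) \<Rightarrow> bool"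
  where "inner_PSP_series g \<longleftrightarrow>
    g holomorphic_on ball 0 1 \<and>
    (\<exists>\<rho> :: complex \<Rightarrow> complex.
       (\<lambda>l. cmod (\<rho> l)) summable_on sphere 0 1 \<and>
       (\<forall>z\<in>ball 0 1. g z = (\<Sum>\<^sub>\<infinity>l\<in>sphere 0 1. \<rho> l / (z - l))))"

text \<open>The index \<open>n + k\<^sub>j\<close> is negative for at most finitely many \<open>j\<close>, so the truncation
  performed by \<^const>\<open>nat\<close> does not affect the limit.\<close>

definition right_limit :: "(nat \<Rightarrow> complex) \<Rightarrow> (int \<Rightarrow> complex) \<Rightarrow> bool"
  where "right_limit a b \<longleftrightarrow>
    bounded (range a) \<and>
    (\<exists>k :: nat \<Rightarrow> nat. strict_mono k \<and> (\<forall>j. 0 < k j) \<and>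
       (\<forall>n. (\<lambda>j. a (nat (n + int (k j)))) \<longlonglongrightarrow> b n))"

definition renascent_right_limit :: "(nat \<Rightarrow> complex) \<Rightarrow> (int \<Rightarrow> complex) \<Rightarrow> bool"
  where "renascent_right_limit a b \<longleftrightarrow> right_limit a b \<and> (\<forall>n. b (int n) = a n)"

text \<open>The Riemann sphere is represented by \<^typ>\<open>complex option\<close>, where \<^term>\<open>None\<close> is the point
  at infinity (as in \<^const>\<open>Alexandroff_compactification\<close>).\<close>

definition exterior_disc :: "complex option set"
  where "exterior_disc = insert None (Some ` {z. 1 < cmod z})"

text \<open>The map \<open>z \<mapsto> 1/z\<close>, sending infinity to 0. It is only used on \<^const>\<open>exterior_disc\<close>, so
  its value at \<^term>\<open>Some 0\<close> is irrelevant.\<close>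

fun sphere_inverse :: "complex option \<Rightarrow> complex"
  where
    "sphere_inverse None = 0"
  | "sphere_inverse (Some z) = inverse z"

text \<open>For \<open>n < 0\<close> the power \<open>w\<^sup>n\<close> on the exterior disc is \<open>(1/w)\<^sup>-\<^sup>n\<close>.\<close>

definition neg_power :: "complex option \<Rightarrow> int \<Rightarrow> complex"
  where "neg_power w n = sphere_inverse w ^ nat (- n)"

text \<open>Functions are total in HOL: \<open>g\<close> matters only on the unit disc and \<open>h\<close> only on
  \<^const>\<open>exterior_disc\<close>, so continuations are compared on \<^const>\<open>exterior_disc\<close> only.\<close>

definition rrl_continuation :: "(complex \<Rightarrow> complex) \<Rightarrow> (complex option \<Rightarrow> complex) \<Rightarrow> bool"
  where "rrl_continuation g h \<longleftrightarrow>
    g holomorphic_on ball 0 1 \<and>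
    (\<exists>a b. bounded (range a) \<and>
       (\<forall>z\<in>ball 0 1. (\<lambda>k. a k * z ^ k) sums g z) \<and>
       renascent_right_limit a b \<and>
       (\<forall>w\<in>exterior_disc. h w = - (\<Sum>\<^sub>\<infinity>n\<in>{..<0}. b n * neg_power w n)))"

definition uniquely_rrl_continuable :: "(complex \<Rightarrow> complex) \<Rightarrow> bool"
  where "uniquely_rrl_continuable g \<longleftrightarrow>
    (\<exists>h. rrl_continuation g h \<and>
       (\<forall>h'. rrl_continuation g h' \<longrightarrow> (\<forall>w\<in>exterior_disc. h' w = h w)))"

definition strong_natural_boundary :: "(complex \<Rightarrow> complex) \<Rightarrow> bool"
  where "strong_natural_boundary g \<longleftrightarrow>
    g holomorphic_on ball 0 1 \<and>
    (\<forall>\<omega>1 \<omega>2 :: real. \<omega>1 < \<omega>2 \<longrightarrow>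
       (SUP r\<in>{0<..<1::real}.
          \<integral>\<^sup>+\<omega>\<in>{\<omega>1<..<\<omega>2}. ennreal (cmod (g (of_real r * cis \<omega>))) \<partial>lborel) = \<infinity>)"

definition g_plus :: "real \<Rightarrow> real \<Rightarrow> complex \<Rightarrow> complex"
  where "g_plus \<theta> \<gamma> z = (\<Sum>n. of_real (dist_Z (\<gamma> + of_nat n * \<theta>)) * z ^ n)"

definition g_minus :: "real \<Rightarrow> real \<Rightarrow> complex option \<Rightarrow> complex"
  where "g_minus \<theta> \<gamma> w =
    - (\<Sum>\<^sub>\<infinity>n\<in>{..<0}. of_real (dist_Z (\<gamma> + of_int n * \<theta>)) * neg_power w n)"

end

theory Submission
  imports Defs
begin

text \<open>The Fourier series of the distance to the nearest integer is absolutely convergent, with nonzero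
  coefficients exactly at \<open>0\<close> and the odd integers; it is read off from the boundary values of
  the odd part of the dilogarithm. Inserting it into the power series and summing geometric series
  writes \<open>g\<^sub>\<gamma>\<^sup>+\<close> as a sum of simple poles at the points \<open>e\<^sup>-\<^sup>2\<^sup>\<pi>\<^sup>i\<^sup>m\<^sup>\<theta>\<close>.

  If the coefficient sequence, shifted by \<open>k\<^sub>j\<close>, reproduces itself in the limit, then, evaluating at
  an index where the coefficient is almost zero, \<open>k\<^sub>j \<theta>\<close> tends to \<open>0\<close> modulo one; this determines
  the right limit.

  For the natural boundary, approach a pole: by absolute convergence of the residues, in every
  nontangential region the term of this pole dominates all the others together.\<close>

section \<open>The odd dilogarithm on the unit circle\<close>

definition odd_dilog_coeff :: "nat \<Rightarrow> complex"
  where "odd_dilog_coeff n = (if odd n then 1 / of_nat n ^ 2 else 0)"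

text \<open>The Legendre chi function of order two, that is (Li_2(z) - Li_2(-z)) / 2.\<close>

definition odd_dilog :: "complex \<Rightarrow> complex"
  where "odd_dilog z = (\<Sum>n. odd_dilog_coeff n * z ^ n)"

lemma summable_norm_odd_dilog_coeff: "summable (\<lambda>n. norm (odd_dilog_coeff n))"
proof (rule summable_comparison_test')
  show "summable (\<lambda>n. 1 / real n ^ 2)"
    using inverse_power_summable[of 2, where ?'a=real] by (simp add: inverse_eq_divide)
qed (auto simp: odd_dilog_coeff_def norm_divide norm_power)

lemma summable_norm_odd_dilog:
  assumes "norm z \<le> 1"
  shows "summable (\<lambda>n. norm (odd_dilog_coeff n * z ^ n))"
proof (rule summable_comparison_test'[OF summable_norm_odd_dilog_coeff])
  show "norm (norm (odd_dilog_coeff n * z ^ n)) \<le> norm (odd_dilog_coeff n)" for n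
    using assms by (simp add: norm_mult norm_power mult_left_le power_le_one)
qed

lemma odd_dilog_sums:
  assumes "norm z \<le> 1"
  shows "(\<lambda>n. odd_dilog_coeff n * z ^ n) sums odd_dilog z"
  unfolding odd_dilog_def
  by (rule summable_sums[OF summable_norm_cancel[OF summable_norm_odd_dilog[OF assms]]])

text \<open>The coefficients are absolutely summable, so the M-test works up to the unit circle.
  Boundary values can therefore be computed as radial limits.\<close>

lemma continuous_on_odd_dilog: "continuous_on (cball 0 1) odd_dilog"
proof (rule uniform_limit_theorem)
  show "uniform_limit (cball 0 1) (\<lambda>N z. \<Sum>n<N. odd_dilog_coeff n * z ^ n) odd_dilog sequentially"
    unfolding odd_dilog_def
    by (rule Weierstrass_m_test[OF _ summable_norm_odd_dilog_coeff])
       (simp add: norm_mult norm_power mult_left_le power_le_one)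
qed (auto intro!: always_eventually continuous_intros)

text \<open>Multiplying the derivative by z turns 1/n^2 into 1/n and leaves the series of artanh.
  The product \<open>D * z\<close> needs no division at z = 0 and is what differentiation along a
  circle produces.\<close>

lemma odd_dilog_deriv:
  assumes "norm z < 1"
  obtains D where "(odd_dilog has_field_derivative D) (at z)"
    "D * z = (Ln (1 + z) - Ln (1 - z)) / 2"
proof
  let ?D = "\<Sum>n. diffs odd_dilog_coeff n * z ^ n"
  have sm: "summable (\<lambda>n. odd_dilog_coeff n * w ^ n)" if "norm w < 1" for w
    using that odd_dilog_sums[of w] by (auto simp: sums_iff)
  show "(odd_dilog has_field_derivative ?D) (at z)"
    unfolding odd_dilog_def using sm assms by (rule termdiffs_strong')
  have "summable (\<lambda>n. diffs odd_dilog_coeff n * z ^ n)"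
    by (rule termdiff_converges[OF assms sm])
  from sums_mult2[OF diffs_equiv[OF this], of z]
  moreover have "of_nat n * odd_dilog_coeff n * z ^ (n - Suc 0) * z = of_nat n * odd_dilog_coeff n * z ^ n" for n
    by (cases n) auto
  ultimately have "(\<lambda>n. of_nat n * odd_dilog_coeff n * z ^ n) sums (?D * z)"
    by simp
  moreover have "(\<lambda>n. of_nat n * odd_dilog_coeff n * z ^ n) sums ((Ln (1 + z) - Ln (1 - z)) / 2)"
  proof -
    \<comment> \<open>The even powers cancel. At n = 0 the quotients are zero, since division by
      zero yields zero.\<close>
    have "(\<lambda>n. (- ((- z) ^ n) / of_nat n - - ((- (- z)) ^ n) / of_nat n) / 2)
        sums ((Ln (1 + z) - Ln (1 + - z)) / 2)"
      using assms by (intro sums_divide sums_diff Ln_series') auto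
    moreover have "(- ((- z) ^ n) / of_nat n - - ((- (- z)) ^ n) / of_nat n) / 2 =
        of_nat n * odd_dilog_coeff n * z ^ n" for n
      by (auto simp: odd_dilog_coeff_def power2_eq_square)
    ultimately show ?thesis by simp
  qed
  ultimately show "?D * z = (Ln (1 + z) - Ln (1 - z)) / 2"
    by (rule sums_unique2)
qed

text \<open>The Moebius image (1 + z) / (1 - z) lies in the right half-plane, where the imaginary
  part of the logarithm is the arctangent of Im / Re.\<close>

lemma Im_Ln_quotient:
  fixes r x :: real
  assumes "0 < r" "r < 1"
  defines "z \<equiv> of_real r * cis x"
  shows "Im (Ln (1 + z) - Ln (1 - z)) = arctan (2 * r * sin x / (1 - r\<^sup>2))"
proof -
  define w where "w = (1 + z) / (1 - z)"
  have nz: "norm z < 1" using assms by (simp add: norm_mult)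
  have r2: "r\<^sup>2 < 1" using assms by (simp add: power_less_one_iff)
  have re: "\<bar>Re z\<bar> < 1" using nz abs_Re_le_cmod[of z] by linarith
  have ne: "1 - z \<noteq> 0" "1 + z \<noteq> 0" using re by (auto simp: complex_eq_iff)
  define N where "N = (1 - Re z)\<^sup>2 + (Im z)\<^sup>2"
  have N: "N > 0" using re unfolding N_def by (simp add: add_pos_nonneg)
  have rez: "(Re z)\<^sup>2 + (Im z)\<^sup>2 = r\<^sup>2"
    by (simp add: z_def power_mult_distrib flip: distrib_left)
  have Re: "Re w = (1 - r\<^sup>2) / N" 
    using rez unfolding w_def N_def Re_divide by (simp add: power2_eq_square algebra_simps)
  have Im: "Im w = 2 * r * sin x / N"
    unfolding w_def N_def Im_divide by (simp add: z_def power2_eq_square algebra_simps)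
  have Rw: "Re w > 0" using N r2 by (simp add: Re)
  then have w0: "w \<noteq> 0" by auto
  \<comment> \<open>Two arguments below pi/2 in absolute value add up without leaving the principal
    branch, so the logarithm is additive here.\<close>
  have "\<bar>Im (Ln w)\<bar> < pi / 2" "\<bar>Im (Ln (1 - z))\<bar> < pi / 2"
    unfolding Re_Ln_pos_lt[OF w0] Re_Ln_pos_lt[OF ne(1)] using Rw re by auto
  then have "Ln (w * (1 - z)) = Ln w + Ln (1 - z)"
    by (intro Ln_times_simple w0 ne) auto
  then have "Ln (1 + z) - Ln (1 - z) = Ln w" using ne by (simp add: w_def)
  moreover have "Im (Ln w) = arctan (Im w / Re w)"
    using Rw w0 by (metis Arg_eq_Im_Ln arg_conv_arctan)
  moreover have "Im w / Re w = 2 * r * sin x / (1 - r\<^sup>2)"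
    using N by (simp add: Re Im)
  ultimately show ?thesis by simp
qed

text \<open>Differentiating in the angle multiplies \<open>D * z\<close> by the imaginary unit, so
  the real part becomes minus the imaginary part of the logarithms.\<close>

lemma DERIV_Re_odd_dilog_circle:
  assumes "0 < r" "r < 1"
  shows "((\<lambda>x. Re (odd_dilog (of_real r * cis x))) has_real_derivative
           - arctan (2 * r * sin x / (1 - r\<^sup>2)) / 2) (at x)"
proof -
  let ?z = "of_real r * cis x"
  obtain D where D: "(odd_dilog has_field_derivative D) (at ?z)"
    "D * ?z = (Ln (1 + ?z) - Ln (1 - ?z)) / 2"
    using odd_dilog_deriv[of ?z] assms by (auto simp: norm_mult)
  have "((\<lambda>x. of_real r * cis x) has_vector_derivative (of_real r * (\<i> * cis x))) (at x)"
    unfolding has_vector_derivative_def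
    by (auto intro!: derivative_eq_intros simp: scaleR_conv_of_real algebra_simps)
  from bounded_linear.has_vector_derivative[OF bounded_linear_Re field_vector_diff_chain_at[OF this D(1)]]
  have "((\<lambda>x. Re (odd_dilog (of_real r * cis x))) has_real_derivative
          Re (of_real r * (\<i> * cis x) * D)) (at x)"
    by (simp add: has_real_derivative_iff_has_vector_derivative o_def)
  moreover have "of_real r * (\<i> * cis x) * D = \<i> * (D * ?z)" by (simp add: algebra_simps)
  then have "Re (of_real r * (\<i> * cis x) * D) = - arctan (2 * r * sin x / (1 - r\<^sup>2)) / 2"
    by (simp only: D(2) Re_i_times Im_divide_numeral Im_Ln_quotient[OF assms] minus_divide_left)
  ultimately show ?thesis by simp
qed

text \<open>This fixes the constant of integration along the circle without knowing any zeta value.\<close>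

lemma Re_odd_dilog_imaginary:
  assumes "0 \<le> r" "r \<le> 1"
  shows "Re (odd_dilog (of_real r * cis (pi / 2))) = 0"
proof -
  have "(\<lambda>n. Re (odd_dilog_coeff n * (of_real r * cis (pi / 2)) ^ n)) sums
        Re (odd_dilog (of_real r * cis (pi / 2)))"
    using assms by (intro sums_Re odd_dilog_sums) (auto simp: norm_mult)
  moreover have "Re (odd_dilog_coeff n * (of_real r * cis (pi / 2)) ^ n) = 0" for n
  proof (cases "odd n")
    case True
    then obtain k where n: "n = 2 * k + 1" by (auto elim: oddE)
    have "\<i> ^ n = (- 1) ^ k * \<i>" by (simp add: n power_mult)
    moreover have "odd_dilog_coeff n = of_real (1 / real n ^ 2)"
      using True by (simp add: odd_dilog_coeff_def)
    ultimately have "odd_dilog_coeff n * (of_real r * cis (pi / 2)) ^ n =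
       of_real (1 / real n ^ 2 * r ^ n * (- 1) ^ k) * \<i>"
      by (simp add: power_mult_distrib)
    then show ?thesis by (simp only: Re_complex_of_real times_complex.sel) simp
  qed (simp add: odd_dilog_coeff_def)
  ultimately show ?thesis by (simp add: sums_iff)
qed

lemma continuous_on_odd_dilog_radius: "continuous_on {0..1} (\<lambda>r. Re (odd_dilog (of_real r * cis x)))"
  by (intro continuous_intros continuous_on_compose2[OF continuous_on_odd_dilog])
     (auto simp: norm_mult)

text \<open>As r tends to 1 the angular derivative tends to -pi/4 on the upper half circle, which
  makes the boundary values linear in x. The value at pi/2 supplies the constant.\<close>

lemma Re_odd_dilog_cis_interior:
  assumes x: "0 < x" "x < pi"
  shows "Re (odd_dilog (cis x)) = pi\<^sup>2 / 8 - pi * x / 4"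
proof -
  define B where "B r = pi / 4 - arctan (2 * r * sin x / (1 - r\<^sup>2)) / 2" for r
  have bound: "\<bar>Re (odd_dilog (of_real r * cis x)) + pi * (x - pi / 2) / 4\<bar> \<le> B r * \<bar>x - pi / 2\<bar>"
    if r: "0 < r" "r < 1" for r
  proof -
    \<comment> \<open>The added term cancels the limiting slope -pi/4, so \<open>?G\<close> is
      nearly constant for r close to 1.\<close>
    let ?G = "\<lambda>y. Re (odd_dilog (of_real r * cis y)) + pi * y / 4"
    let ?S = "closed_segment x (pi / 2)"
    have r2: "r\<^sup>2 < 1" using r by (simp add: power_less_one_iff)
    have "norm (?G x - ?G (pi / 2)) \<le> B r * norm (x - pi / 2)"
    proof (rule field_differentiable_bound[where S="?S" and f="?G"
          and f'="\<lambda>y. pi / 4 - arctan (2 * r * sin y / (1 - r\<^sup>2)) / 2"])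
      fix y assume y: "y \<in> ?S"
      show "(?G has_field_derivative pi / 4 - arctan (2 * r * sin y / (1 - r\<^sup>2)) / 2) (at y within ?S)"
      proof (rule has_field_derivative_at_within)
        have "((\<lambda>y. pi * y / 4) has_real_derivative pi / 4) (at y)"
          by (auto intro!: derivative_eq_intros)
        from DERIV_add[OF DERIV_Re_odd_dilog_circle[OF r] this]
        show "(?G has_field_derivative pi / 4 - arctan (2 * r * sin y / (1 - r\<^sup>2)) / 2) (at y)"
          by (simp add: algebra_simps)
      qed
      \<comment> \<open>On the segment from x to pi/2 the sine is smallest at x, so the derivative
        bound taken at x, namely \<open>B r\<close>, holds on all of it.\<close>
      have "\<bar>y - pi / 2\<bar> \<le> \<bar>x - pi / 2\<bar>" "\<bar>x - pi / 2\<bar> \<le> pi"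
        using y x by (auto simp: closed_segment_eq_real_ivl split: if_splits)
      then have "cos \<bar>x - pi / 2\<bar> \<le> cos \<bar>y - pi / 2\<bar>"
        by (intro cos_monotone_0_pi_le) auto
      then have "sin x \<le> sin y" by (simp add: cos_diff)
      then have "2 * r * sin x / (1 - r\<^sup>2) \<le> 2 * r * sin y / (1 - r\<^sup>2)"
        using r r2 by (intro divide_right_mono mult_left_mono) auto
      then have "arctan (2 * r * sin x / (1 - r\<^sup>2)) \<le> arctan (2 * r * sin y / (1 - r\<^sup>2))"
        by (simp only: arctan_le_iff)
      then show "norm (pi / 4 - arctan (2 * r * sin y / (1 - r\<^sup>2)) / 2) \<le> B r"
        using arctan_ubound[of "2 * r * sin y / (1 - r\<^sup>2)"] by (simp add: B_def)
    qed auto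
    then show ?thesis using Re_odd_dilog_imaginary[of r] r
      by (simp add: right_diff_distrib diff_divide_distrib)
  qed
  have fl: "filterlim (\<lambda>r. 2 * r * sin x / (1 - r\<^sup>2)) at_top (at_left (1::real))"
  proof -
    have "((\<lambda>r::real. 2 * r * sin x) \<longlongrightarrow> 2 * 1 * sin x) (at_left 1)"
      by (intro tendsto_intros)
    moreover have "((\<lambda>r::real. 1 - r\<^sup>2) \<longlongrightarrow> 1 - 1\<^sup>2) (at_left 1)" by (intro tendsto_intros)
    moreover have "eventually (\<lambda>r::real. 0 < 1 - r\<^sup>2) (at_left 1)"
      unfolding eventually_at_left_field
      by (rule exI[of _ 0]) (auto simp: power_less_one_iff)
    ultimately show ?thesis using sin_gt_zero[OF x]
      by (intro LIM_at_top_divide[where a="2 * 1 * sin x"]) simp_all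
  qed
  have "(B \<longlongrightarrow> pi / 4 - (pi / 2) / 2) (at_left 1)"
    unfolding B_def by (intro tendsto_intros filterlim_compose[OF tendsto_arctan_at_top fl]) auto
  then have "((\<lambda>r. B r * \<bar>x - pi / 2\<bar>) \<longlongrightarrow> 0) (at_left 1)"
    by (auto intro!: tendsto_mult_left_zero)
  then have "((\<lambda>r. Re (odd_dilog (of_real r * cis x)) + pi * (x - pi / 2) / 4) \<longlongrightarrow> 0) (at_left 1)"
  proof (rule Lim_null_comparison[rotated])
    show "\<forall>\<^sub>F r in at_left 1. norm (Re (odd_dilog (of_real r * cis x)) + pi * (x - pi / 2) / 4)
        \<le> B r * \<bar>x - pi / 2\<bar>"
      unfolding eventually_at_left_field by (rule exI[of _ 0]) (use bound in auto)
  qed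
  moreover have "((\<lambda>r. Re (odd_dilog (of_real r * cis x)) + pi * (x - pi / 2) / 4) \<longlongrightarrow>
      Re (odd_dilog (of_real 1 * cis x)) + pi * (x - pi / 2) / 4) (at_left 1)"
    by (intro tendsto_add tendsto_const continuous_on_Icc_at_leftD[OF continuous_on_odd_dilog_radius]) simp
  ultimately have "Re (odd_dilog (of_real 1 * cis x)) + pi * (x - pi / 2) / 4 = 0"
    by (intro tendsto_unique[of "at_left (1::real)"]) auto
  then show ?thesis by (simp add: power2_eq_square field_simps)
qed

lemma Re_odd_dilog_cis:
  assumes "0 \<le> x" "x \<le> pi"
  shows "Re (odd_dilog (cis x)) = pi\<^sup>2 / 8 - pi * x / 4"
proof -
  let ?f = "\<lambda>x. Re (odd_dilog (cis x)) + pi * x / 4"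
  have "?f x = pi\<^sup>2 / 8"
  proof (rule continuous_constant_on_closure[where S="{0<..<pi}" and f="?f"])
    show "continuous_on (closure {0<..<pi}) ?f"
      by (intro continuous_intros continuous_on_compose2[OF continuous_on_odd_dilog]) auto
  qed (use assms in \<open>auto simp: Re_odd_dilog_cis_interior\<close>)
  then show ?thesis by simp
qed

section \<open>Fourier series of the distance to the integers\<close>

lemma dist_Z_le: "dist_Z t \<le> \<bar>t - of_int n\<bar>"
  unfolding dist_Z_def using infdist_le[of "of_int n" \<int> t] by (simp add: dist_real_def)

lemma dist_Z_eq_round: "dist_Z t = \<bar>t - of_int (round t)\<bar>"
proof (rule antisym[OF dist_Z_le])
  have "(\<int> :: real set) \<noteq> {}" using Ints_0 by blast
  then show "\<bar>t - of_int (round t)\<bar> \<le> dist_Z t"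
    unfolding dist_Z_def infdist_notempty[OF \<open>\<int> \<noteq> {}\<close>]
    by (intro cINF_greatest) (auto elim!: Ints_cases simp: dist_real_def round_diff_minimal)
qed

lemma dist_Z_nonneg: "0 \<le> dist_Z t"
  by (simp add: dist_Z_def infdist_nonneg)

lemma dist_Z_le_half: "dist_Z t \<le> 1 / 2"
  using of_int_round_abs_le[of t] by (simp add: dist_Z_eq_round abs_minus_commute)

lemma dist_Z_add_le: "dist_Z (s + t) \<le> dist_Z s + dist_Z t"
  using dist_Z_le[of "s + t" "round s + round t"] by (simp add: dist_Z_eq_round)

lemma dist_Z_minus [simp]: "dist_Z (- t) = dist_Z t"
proof -
  have "dist_Z (- t) \<le> dist_Z t" for t
    using dist_Z_le[of "- t" "- round t"] by (simp add: dist_Z_eq_round)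
  from this[of t] this[of "- t"] show ?thesis by simp
qed

text \<open>This controls how a shift of the index perturbs the coefficients: a shift by k costs at
  most \<open>dist_Z (k * \<theta>)\<close>, uniformly in the index.\<close>

lemma abs_dist_Z_diff_le: "\<bar>dist_Z (s + t) - dist_Z s\<bar> \<le> dist_Z t"
  using dist_Z_add_le[of s t] dist_Z_add_le[of "s + t" "- t"] by simp

text \<open>Fourier coefficients of the triangle wave \<open>dist_Z\<close>, whose mean value is
  1/4.\<close>

definition dist_Z_coeff :: "int \<Rightarrow> real"
  where "dist_Z_coeff m = (if m = 0 then 1 / 4 else if odd m then - 1 / (pi * of_int m)\<^sup>2 else 0)"

lemma odd_dilog_cnj:
  assumes "norm z \<le> 1"
  shows "odd_dilog (cnj z) = cnj (odd_dilog z)"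
proof -
  have [simp]: "cnj (odd_dilog_coeff n) = odd_dilog_coeff n" for n
    by (simp add: odd_dilog_coeff_def)
  have "(\<lambda>n. cnj (odd_dilog_coeff n * z ^ n)) sums cnj (odd_dilog z)"
    using odd_dilog_sums[OF assms] by (subst sums_cnj)
  then have "(\<lambda>n. odd_dilog_coeff n * cnj z ^ n) sums cnj (odd_dilog z)" by simp
  moreover have "(\<lambda>n. odd_dilog_coeff n * cnj z ^ n) sums odd_dilog (cnj z)"
    using assms by (intro odd_dilog_sums) simp
  ultimately show ?thesis by (metis sums_unique2)
qed

text \<open>Periodicity moves t into [-1/2, 1/2], and conjugation, which keeps the real part,
  removes its sign. The angle then lies in [0, pi].\<close>

lemma Re_odd_dilog_cis_dist_Z: "Re (odd_dilog (cis (2 * pi * t))) = pi\<^sup>2 / 8 - pi\<^sup>2 * dist_Z t / 2"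
proof -
  define u where "u = t - of_int (round t)"
  have u: "\<bar>u\<bar> = dist_Z t" by (simp add: u_def dist_Z_eq_round)
  have "cis (2 * pi * t) = cis (2 * pi * u) * cis (2 * pi * of_int (round t))"
    unfolding cis_mult by (simp add: u_def algebra_simps)
  also have "\<dots> = cis (2 * pi * u)" by simp
  finally have "cis (2 * pi * t) = cis (2 * pi * u)" .
  moreover have "Re (odd_dilog (cis (2 * pi * u))) = Re (odd_dilog (cis (2 * pi * \<bar>u\<bar>)))"
  proof (cases "u \<ge> 0")
    case False
    then have "cis (2 * pi * u) = cnj (cis (2 * pi * \<bar>u\<bar>))"
      by (simp add: cis_cnj)
    then show ?thesis by (simp add: odd_dilog_cnj)
  qed auto
  moreover have "2 * \<bar>u\<bar> \<le> 1" using dist_Z_le_half[of t] by (simp add: u)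
  then have "2 * pi * \<bar>u\<bar> \<le> pi" using mult_left_mono[of "2 * \<bar>u\<bar>" 1 pi] by (simp add: algebra_simps)
  then have "Re (odd_dilog (cis (2 * pi * \<bar>u\<bar>))) = pi\<^sup>2 / 8 - pi * (2 * pi * \<bar>u\<bar>) / 4"
    by (intro Re_odd_dilog_cis) auto
  ultimately show ?thesis by (simp add: u power2_eq_square)
qed

lemma odd_dilog_has_sum:
  assumes "norm z \<le> 1"
  shows "((\<lambda>n. odd_dilog_coeff n * z ^ n) has_sum odd_dilog z) {0<..}"
proof -
  have "((\<lambda>n. odd_dilog_coeff n * z ^ n) has_sum odd_dilog z) UNIV"
    using assms by (intro norm_summable_imp_has_sum summable_norm_odd_dilog odd_dilog_sums)
  then show ?thesis
    by (rule has_sum_cong_neutral[THEN iffD1, rotated -1]) (auto simp: odd_dilog_coeff_def)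
qed

text \<open>The positive and the negative frequencies each sum to -1/pi^2 times
  \<open>odd_dilog\<close>, at conjugate points. Together they give a real part, and the frequency 0
  adds the mean.\<close>

lemma dist_Z_fourier:
  "((\<lambda>m. of_real (dist_Z_coeff m) * cis (2 * pi * of_int m * t)) has_sum complex_of_real (dist_Z t)) UNIV"
proof -
  let ?f = "\<lambda>m. of_real (dist_Z_coeff m) * cis (2 * pi * of_int m * t)"
  let ?z = "cis (2 * pi * t)"
  \<comment> \<open>The sign s treats both halves of the nonzero integers at once.\<close>
  have half: "(?f has_sum (- 1 / of_real (pi\<^sup>2) * odd_dilog (cis (2 * pi * of_int s * t)))) ((\<lambda>m. s * int m) ` {0<..})"
    if s: "s = 1 \<or> s = - 1" for s
  proof (subst has_sum_reindex)
    show "inj_on (\<lambda>m. s * int m) {0<..}" using s by (auto simp: inj_on_def)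
    have "((\<lambda>n. - 1 / of_real (pi\<^sup>2) * (odd_dilog_coeff n * cis (2 * pi * of_int s * t) ^ n)) has_sum
        (- 1 / of_real (pi\<^sup>2) * odd_dilog (cis (2 * pi * of_int s * t)))) {0<..}"
      by (intro has_sum_cmult_right odd_dilog_has_sum) simp
    then show "(?f \<circ> (\<lambda>m. s * int m) has_sum
        (- 1 / of_real (pi\<^sup>2) * odd_dilog (cis (2 * pi * of_int s * t)))) {0<..}"
    proof (rule has_sum_cong[THEN iffD1, rotated])
      fix n :: nat assume n: "n \<in> {0<..}"
      have "cis (2 * pi * of_int s * t) ^ n = cis (2 * pi * of_int (s * int n) * t)"
        unfolding Complex.DeMoivre by (simp add: algebra_simps)
      moreover have "- 1 / of_real (pi\<^sup>2) * odd_dilog_coeff n = of_real (dist_Z_coeff (s * int n))"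
        using n s by (auto simp: odd_dilog_coeff_def dist_Z_coeff_def power_mult_distrib)
      ultimately show "- 1 / of_real (pi\<^sup>2) * (odd_dilog_coeff n * cis (2 * pi * of_int s * t) ^ n) =
          (?f \<circ> (\<lambda>m. s * int m)) n"
        by (simp only: o_def mult.assoc[symmetric])
    qed
  qed
  have pos: "(\<lambda>m. 1 * int m) ` {0<..} = {0<..}"
    by (auto simp: image_iff) (metis nat_0_less_mult_iff zero_less_nat_eq int_nat_eq less_imp_le greaterThan_iff)
  have neg: "(\<lambda>m. - 1 * int m) ` {0<..} = {..<0}"
  proof (intro set_eqI iffI)
    fix m :: int assume "m \<in> {..<0}"
    then show "m \<in> (\<lambda>m. - 1 * int m) ` {0<..}" by (intro image_eqI[of _ _ "nat (- m)"]) auto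
  qed auto
  have "(?f has_sum (?f 0 + (- 1 / of_real (pi\<^sup>2) * odd_dilog ?z + - 1 / of_real (pi\<^sup>2) * odd_dilog (cnj ?z))))
      ({0} \<union> ({0<..} \<union> {..<0}))"
  proof (intro has_sum_Un_disjoint)
    show "(?f has_sum ?f 0) {0}" by (rule has_sum_finiteI) auto
    show "(?f has_sum (- 1 / of_real (pi\<^sup>2) * odd_dilog ?z)) {0<..}"
      using half[of 1] unfolding pos by simp
    show "(?f has_sum (- 1 / of_real (pi\<^sup>2) * odd_dilog (cnj ?z))) {..<0}"
      using half[of "- 1"] unfolding neg by (simp add: cis_cnj)
  qed auto
  also have "{0} \<union> ({0<..} \<union> {..<0}) = (UNIV :: int set)" by auto
  also have "?f 0 + (- 1 / of_real (pi\<^sup>2) * odd_dilog ?z + - 1 / of_real (pi\<^sup>2) * odd_dilog (cnj ?z)) =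
      of_real (1 / 4 - 2 / pi\<^sup>2 * Re (odd_dilog ?z))"
    by (simp add: odd_dilog_cnj dist_Z_coeff_def complex_eq_iff Re_divide Im_divide power2_eq_square field_simps)
  also have "1 / 4 - 2 / pi\<^sup>2 * Re (odd_dilog ?z) = dist_Z t"
    unfolding Re_odd_dilog_cis_dist_Z by (simp add: field_simps)
  finally show ?thesis .
qed

text \<open>At t = 0 all exponentials are 1, and unconditional summability of complex numbers is
  absolute.\<close>

lemma summable_dist_Z_coeff: "(\<lambda>m. \<bar>dist_Z_coeff m\<bar>) summable_on UNIV"
proof -
  have "(\<lambda>m. complex_of_real (dist_Z_coeff m)) summable_on UNIV"
    using has_sum_imp_summable[OF dist_Z_fourier[of 0]] by simp
  then show ?thesis by (simp add: summable_on_iff_abs_summable_on_complex)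
qed

section \<open>Right limits\<close>

text \<open>The multiples of an irrational \<theta> are dense modulo one.\<close>

lemma ex_dist_Z_less:
  assumes "\<theta> \<notin> \<rat>" "\<epsilon> > 0"
  obtains n :: nat where "n > N" "dist_Z (\<gamma> + of_nat n * \<theta>) < \<epsilon>"
proof -
  \<comment> \<open>Aiming at -\<gamma> - N\<theta> with a positive multiple k makes k + N an index
    beyond N.\<close>
  obtain h k where k: "k > 0" "\<bar>of_int k * \<theta> - of_int h - (- \<gamma> - of_nat N * \<theta>)\<bar> < \<epsilon>"
    using sequence_of_fractional_parts_is_dense[OF assms] .
  have "\<gamma> + of_nat (nat k + N) * \<theta> - of_int h = of_int k * \<theta> - of_int h - (- \<gamma> - of_nat N * \<theta>)"
    using k(1) by (simp add: algebra_simps)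
  then have "dist_Z (\<gamma> + of_nat (nat k + N) * \<theta>) < \<epsilon>"
    using dist_Z_le[of "\<gamma> + of_nat (nat k + N) * \<theta>" h] k(2) by simp
  then show thesis using k(1) by (intro that[of "nat k + N"]) auto
qed

lemma tendsto_dist_Z_shift:
  fixes k :: "nat \<Rightarrow> nat"
  assumes "strict_mono k" and lim: "(\<lambda>j. dist_Z (of_nat (k j) * \<theta>)) \<longlonglongrightarrow> 0"
  shows "(\<lambda>j. complex_of_real (dist_Z (\<gamma> + of_nat (nat (n + int (k j))) * \<theta>)))
    \<longlonglongrightarrow> of_real (dist_Z (\<gamma> + of_int n * \<theta>))"
proof (rule tendsto_of_real[OF LIM_zero_cancel[OF Lim_null_comparison[OF _ lim]]])
  show "\<forall>\<^sub>F j in sequentially. norm (dist_Z (\<gamma> + of_nat (nat (n + int (k j))) * \<theta>) -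
      dist_Z (\<gamma> + of_int n * \<theta>)) \<le> dist_Z (of_nat (k j) * \<theta>)"
    \<comment> \<open>A strictly increasing k satisfies \<open>k j \<ge> j\<close>, so from here on
      the index is nonnegative and \<open>nat\<close> truncates nothing.\<close>
    using eventually_ge_at_top[of "nat (- n)"]
  proof eventually_elim
    case (elim j)
    have "n + int (k j) \<ge> 0" using elim seq_suble[OF assms(1), of j] by linarith
    then have "\<gamma> + of_nat (nat (n + int (k j))) * \<theta> = (\<gamma> + of_int n * \<theta>) + of_nat (k j) * \<theta>"
      by (simp add: algebra_simps)
    then show ?case
      using abs_dist_Z_diff_le[of "\<gamma> + of_int n * \<theta>" "of_nat (k j) * \<theta>"] by (simp add: add.assoc)
  qed
qed

lemma bounded_dist_Z: "bounded (range (\<lambda>n. complex_of_real (dist_Z (f n))))"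
proof (rule boundedI)
  show "norm x \<le> 1 / 2" if "x \<in> range (\<lambda>n. complex_of_real (dist_Z (f n)))" for x
    using that dist_Z_nonneg dist_Z_le_half by auto
qed

text \<open>The rotation by \<theta> is recurrent: strictly increasing shifts with
  \<open>k n * \<theta>\<close> tending to 0 modulo one can be chosen one after another, and they
  reproduce every coefficient.\<close>

lemma renascent_right_limit_dist_Z:
  assumes "\<theta> \<notin> \<rat>"
  shows "renascent_right_limit (\<lambda>n. of_real (dist_Z (\<gamma> + of_nat n * \<theta>)))
           (\<lambda>n. of_real (dist_Z (\<gamma> + of_int n * \<theta>)))"
proof -
  have ex: "\<exists>y>x. 0 < y \<and> dist_Z (of_nat y * \<theta>) < 1 / Suc n" for n x :: nat
    using ex_dist_Z_less[OF assms, of "1 / Suc n" x 0] by (metis add_0 less_nat_zero_code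
        neq0_conv of_nat_0_less_iff zero_less_Suc zero_less_divide_1_iff)
  have "\<exists>k. \<forall>n. (0 < k n \<and> dist_Z (of_nat (k n) * \<theta>) < 1 / Suc n) \<and> k n < k (Suc n)"
    by (rule dependent_nat_choice) (use ex in blast)+
  then obtain k :: "nat \<Rightarrow> nat" where k: "\<And>n. 0 < k n" "\<And>n. dist_Z (of_nat (k n) * \<theta>) < 1 / Suc n"
    "\<And>n. k n < k (Suc n)" by blast
  have mono: "strict_mono k" using k(3) by (simp add: strict_mono_Suc_iff)
  have "(\<lambda>n. dist_Z (of_nat (k n) * \<theta>)) \<longlonglongrightarrow> 0"
    by (rule tendsto_sandwich[OF _ _ tendsto_const LIMSEQ_Suc[OF lim_1_over_n]])
       (auto intro!: always_eventually less_imp_le[OF k(2)] dist_Z_nonneg simp del: of_nat_Suc)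
  from tendsto_dist_Z_shift[OF mono this] show ?thesis
    unfolding renascent_right_limit_def right_limit_def
    using bounded_dist_Z mono k(1) by auto
qed

lemma renascent_right_limit_dist_Z_unique:
  assumes "\<theta> \<notin> \<rat>"
    and b: "renascent_right_limit (\<lambda>n. of_real (dist_Z (\<gamma> + of_nat n * \<theta>))) b"
  shows "b n = of_real (dist_Z (\<gamma> + of_int n * \<theta>))"
proof -
  obtain k :: "nat \<Rightarrow> nat" where k: "strict_mono k"
    "\<And>n. (\<lambda>j. complex_of_real (dist_Z (\<gamma> + of_nat (nat (n + int (k j))) * \<theta>))) \<longlonglongrightarrow> b n"
    using b unfolding renascent_right_limit_def right_limit_def by blast
  have lim: "(\<lambda>j. dist_Z (\<gamma> + of_nat m * \<theta> + of_nat (k j) * \<theta>)) \<longlonglongrightarrow> dist_Z (\<gamma> + of_nat m * \<theta>)" for m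
  proof -
    have "b (int m) = complex_of_real (dist_Z (\<gamma> + of_nat m * \<theta>))"
      using b unfolding renascent_right_limit_def by blast
    with k(2)[of "int m"] show ?thesis
      by (simp add: nat_int_add tendsto_of_real_iff algebra_simps)
  qed
  have "(\<lambda>j. dist_Z (of_nat (k j) * \<theta>)) \<longlonglongrightarrow> 0"
  proof (rule LIMSEQ_I)
    fix \<epsilon> :: real assume "\<epsilon> > 0"
    \<comment> \<open>In general a value of \<open>dist_Z\<close> leaves the side of the nearest
      integer open, but a value close to zero locates its argument modulo one. Both \<gamma> +
      m\<theta> and its shift by \<open>k j * \<theta>\<close> are eventually within \<epsilon>/2 of
      integers, and subtracting them isolates the shift.\<close>
    then obtain m where m: "dist_Z (\<gamma> + of_nat m * \<theta>) < \<epsilon> / 2"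
      using ex_dist_Z_less[OF assms(1), of "\<epsilon> / 2" 0 \<gamma>] by auto
    have "\<forall>\<^sub>F j in sequentially. dist_Z (\<gamma> + of_nat m * \<theta> + of_nat (k j) * \<theta>) < \<epsilon> / 2"
      using order_tendstoD(2)[OF lim m] .
    then have "\<forall>\<^sub>F j in sequentially. norm (dist_Z (of_nat (k j) * \<theta>) - 0) < \<epsilon>"
    proof eventually_elim
      case (elim j)
      then show ?case
        using m dist_Z_minus[of "\<gamma> + of_nat m * \<theta>"] dist_Z_add_le[of "\<gamma> + of_nat m * \<theta> + of_nat (k j) * \<theta>" "- (\<gamma> + of_nat m * \<theta>)"]
          dist_Z_nonneg[of "of_nat (k j) * \<theta>"] by simp
    qed
    then show "\<exists>N. \<forall>j\<ge>N. norm (dist_Z (of_nat (k j) * \<theta>) - 0) < \<epsilon>"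
      by (simp add: eventually_sequentially)
  qed
  from LIMSEQ_unique[OF k(2) tendsto_dist_Z_shift[OF k(1) this]] show ?thesis .
qed

section \<open>The power series, its coefficients and its continuation\<close>

lemma summable_norm_powser_bounded:
  fixes a :: "nat \<Rightarrow> complex"
  assumes "bounded (range a)" "norm z < 1"
  shows "summable (\<lambda>n. norm (a n * z ^ n))"
proof -
  obtain B where B: "\<And>n. norm (a n) \<le> B" using assms(1) by (auto simp: bounded_iff)
  show ?thesis
  proof (rule summable_comparison_test')
    show "summable (\<lambda>n. B * norm z ^ n)"
      using assms(2) by (intro summable_mult summable_geometric) auto
  qed (use B in \<open>auto simp: norm_mult norm_power intro!: mult_right_mono\<close>)
qed

lemma g_plus_summable:
  assumes "norm z < 1"
  shows "summable (\<lambda>n. norm (complex_of_real (dist_Z (\<gamma> + of_nat n * \<theta>)) * z ^ n))"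
  by (rule summable_norm_powser_bounded[OF bounded_dist_Z assms])

lemma g_plus_sums:
  assumes "norm z < 1"
  shows "(\<lambda>n. complex_of_real (dist_Z (\<gamma> + of_nat n * \<theta>)) * z ^ n) sums g_plus \<theta> \<gamma> z"
  unfolding g_plus_def by (rule summable_sums[OF summable_norm_cancel[OF g_plus_summable[OF assms]]])

lemma g_plus_has_sum:
  assumes "norm z < 1"
  shows "((\<lambda>n. complex_of_real (dist_Z (\<gamma> + of_nat n * \<theta>)) * z ^ n) has_sum g_plus \<theta> \<gamma> z) UNIV"
  by (rule norm_summable_imp_has_sum[OF g_plus_summable[OF assms] g_plus_sums[OF assms]])

lemma g_plus_holomorphic: "g_plus \<theta> \<gamma> holomorphic_on ball 0 1"
proof (unfold holomorphic_on_def field_differentiable_def, intro ballI)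
  fix z :: complex assume z: "z \<in> ball 0 1"
  let ?a = "\<lambda>n. complex_of_real (dist_Z (\<gamma> + of_nat n * \<theta>))"
  have "(g_plus \<theta> \<gamma> has_field_derivative (\<Sum>n. diffs ?a n * z ^ n)) (at z)"
    unfolding g_plus_def[abs_def]
    by (rule termdiffs_strong'[where K=1]) (use z g_plus_sums in \<open>auto simp: sums_iff\<close>)
  then show "\<exists>f'. (g_plus \<theta> \<gamma> has_field_derivative f') (at z within ball 0 1)"
    using has_field_derivative_at_within by blast
qed

text \<open>The coefficients are existentially quantified in \<open>rrl_continuation\<close>;
  uniqueness of a continuation requires that the function determines them.\<close>

lemma powser_coeffs_unique:
  fixes a b :: "nat \<Rightarrow> complex"
  assumes a: "\<And>z. z \<in> ball 0 1 \<Longrightarrow> (\<lambda>n. a n * z ^ n) sums f z"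
    and b: "\<And>z. z \<in> ball 0 1 \<Longrightarrow> (\<lambda>n. b n * z ^ n) sums f z"
  shows "a = b"
proof -
  have rad: "fps_conv_radius (Abs_fps c) > 0"
    if "\<And>z. z \<in> ball 0 1 \<Longrightarrow> (\<lambda>n. c n * z ^ n) sums f z" for c :: "nat \<Rightarrow> complex"
  proof -
    have "summable (\<lambda>n. c n * (1 / 2) ^ n)" using that[of "1 / 2"] by (auto simp: sums_iff)
    from conv_radius_geI[OF this] show ?thesis
      by (simp add: fps_conv_radius_def) (metis ereal_less(2) half_gt_zero less_le_trans zero_less_one)
  qed
  have "\<forall>\<^sub>F z in nhds 0. eval_fps (Abs_fps a) z = eval_fps (Abs_fps b) z"
    using eventually_nhds_in_open[OF open_ball, of 0 0 1]
  proof (rule eventually_mono)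
    show "eval_fps (Abs_fps a) z = eval_fps (Abs_fps b) z" if "z \<in> ball 0 1" for z
      using a[OF that] b[OF that] by (simp add: eval_fps_def sums_iff)
  qed simp
  then have "Abs_fps a = Abs_fps b" by (intro eval_fps_eqD rad a b)
  then show ?thesis by (simp add: fps_eq_iff fun_eq_iff)
qed

lemma rrl_continuation_g_minus:
  assumes "\<theta> \<notin> \<rat>"
  shows "rrl_continuation (g_plus \<theta> \<gamma>) (g_minus \<theta> \<gamma>)"
  unfolding rrl_continuation_def
proof (intro conjI exI)
  show "renascent_right_limit (\<lambda>n. of_real (dist_Z (\<gamma> + of_nat n * \<theta>)))
           (\<lambda>n. of_real (dist_Z (\<gamma> + of_int n * \<theta>)))"
    by (rule renascent_right_limit_dist_Z[OF assms])
qed (auto simp: g_plus_holomorphic bounded_dist_Z g_minus_def intro!: g_plus_sums)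

lemma uniquely_rrl_continuable_g_plus:
  assumes "\<theta> \<notin> \<rat>"
  shows "uniquely_rrl_continuable (g_plus \<theta> \<gamma>)"
  unfolding uniquely_rrl_continuable_def
proof (intro exI[of _ "g_minus \<theta> \<gamma>"] conjI allI impI ballI)
  show "rrl_continuation (g_plus \<theta> \<gamma>) (g_minus \<theta> \<gamma>)"
    by (rule rrl_continuation_g_minus[OF assms])
  fix h w assume "rrl_continuation (g_plus \<theta> \<gamma>) h" and w: "w \<in> exterior_disc"
  then obtain a b where a: "\<And>z. z \<in> ball 0 1 \<Longrightarrow> (\<lambda>k. a k * z ^ k) sums g_plus \<theta> \<gamma> z"
    and b: "renascent_right_limit a b"
    and h: "h w = - (\<Sum>\<^sub>\<infinity>n\<in>{..<0}. b n * neg_power w n)"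
    unfolding rrl_continuation_def by blast
  have "a = (\<lambda>n. complex_of_real (dist_Z (\<gamma> + of_nat n * \<theta>)))"
    using a by (rule powser_coeffs_unique) (auto intro!: g_plus_sums)
  with b have "b n = of_real (dist_Z (\<gamma> + of_int n * \<theta>))" for n
    using renascent_right_limit_dist_Z_unique[OF assms] by blast
  then show "h w = g_minus \<theta> \<gamma> w" by (simp add: h g_minus_def)
qed

lemma norm_sphere_inverse_less: "w \<in> exterior_disc \<Longrightarrow> norm (sphere_inverse w) < 1"
  by (auto simp: exterior_disc_def norm_inverse inverse_less_1_iff)

text \<open>Since \<open>dist_Z\<close> is even, replacing n by -n gives the power series for
  -\<gamma> at 1/w. Only its constant term is missing, which accounts for the subtracted
  \<open>dist_Z \<gamma>\<close>.\<close>

lemma g_minus_has_sum: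
  assumes "w \<in> exterior_disc"
  shows "((\<lambda>n. complex_of_real (dist_Z (\<gamma> + of_int n * \<theta>)) * neg_power w n) has_sum
           (g_plus \<theta> (- \<gamma>) (sphere_inverse w) - of_real (dist_Z \<gamma>))) {..<0}"
proof -
  let ?s = "sphere_inverse w"
  let ?f = "\<lambda>n::nat. complex_of_real (dist_Z (- \<gamma> + of_nat n * \<theta>)) * ?s ^ n"
  have "(?f has_sum (g_plus \<theta> (- \<gamma>) ?s - sum ?f {0})) (UNIV - {0})"
    by (intro has_sum_Diff g_plus_has_sum norm_sphere_inverse_less assms has_sum_finiteI) auto
  then have *: "(?f has_sum (g_plus \<theta> (- \<gamma>) ?s - of_real (dist_Z \<gamma>))) (UNIV - {0})" by simp
  have "dist_Z (\<gamma> + of_int n * \<theta>) = dist_Z (- \<gamma> + of_nat (nat (- n)) * \<theta>)" if "n < 0" for n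
    using that dist_Z_minus[of "\<gamma> + of_int n * \<theta>"] by (simp add: algebra_simps)
  then show ?thesis
    by (subst has_sum_reindex_bij_witness[of _ "\<lambda>n. - int n" "\<lambda>n. nat (- n)" "UNIV - {0}" ?f])
       (use * in \<open>auto simp: neg_power_def\<close>)
qed

section \<open>Inner Poincare simple pole series\<close>

lemma norm_cis_diff_le: "norm (cis a - cis b) \<le> \<bar>a - b\<bar>"
proof -
  have "cis a - cis b = cis b * (cis (a - b) - 1)" by (simp add: algebra_simps cis_mult)
  then have "norm (cis a - cis b) = norm (cis (a - b) - 1)" by (simp add: norm_mult)
  also have "\<dots> = 2 * \<bar>sin ((a - b) / 2)\<bar>" using dist_exp_i_1[of "a - b"] by (simp add: cis_conv_exp)
  also have "\<dots> \<le> \<bar>a - b\<bar>" using abs_sin_x_le_abs_x[of "(a - b) / 2"] by simp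
  finally show ?thesis .
qed

lemma norm_PSP_term_le:
  fixes l z \<rho> :: complex
  assumes "l \<in> sphere 0 1" "norm z \<le> r" "r < 1"
  shows "norm (\<rho> / (z - l)) \<le> norm \<rho> / (1 - r)"
proof -
  have "1 - r \<le> norm (z - l)"
    using assms norm_triangle_ineq2[of l z] by (simp add: norm_minus_commute)
  then show ?thesis using assms by (simp add: norm_divide frac_le)
qed

text \<open>A finite set F of poles carries all but \<epsilon>/2 of the residue mass. Every pole is
  at least \<eta> away from z, so those outside F contribute at most \<epsilon>/(2\<eta>). Those in
  F other than p stay at a fixed distance from z, so their share is bounded while 1/\<eta> grows. C
  is the aperture of the approach region.\<close>

lemma PSP_pole_dominates:
  fixes \<rho> :: "complex \<Rightarrow> complex"
  assumes sum: "(\<lambda>l. cmod (\<rho> l)) summable_on sphere 0 1"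
    and g: "\<And>z. z \<in> ball 0 1 \<Longrightarrow> g z = (\<Sum>\<^sub>\<infinity>l\<in>sphere 0 1. \<rho> l / (z - l))"
    and p: "p \<in> sphere 0 1" and "\<epsilon> > 0" "C > 0"
  obtains \<delta> where "\<delta> > 0"
    "\<And>\<eta> z. \<lbrakk>0 < \<eta>; \<eta> < \<delta>; norm z \<le> 1 - \<eta>; norm (z - p) \<le> C * \<eta>\<rbrakk>
       \<Longrightarrow> norm (g z - \<rho> p / (z - p)) \<le> \<epsilon> / \<eta>"
proof -
  let ?S = "sphere (0::complex) 1"
  obtain F0 where F0: "finite F0" "F0 \<subseteq> ?S"
    "dist (\<Sum>l\<in>F0. cmod (\<rho> l)) (\<Sum>\<^sub>\<infinity>l\<in>?S. cmod (\<rho> l)) \<le> \<epsilon> / 2"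
    using infsum_finite_approximation[OF sum, of "\<epsilon> / 2"] \<open>\<epsilon> > 0\<close> by auto
  define F where "F = insert p F0"
  have F: "finite F" "F \<subseteq> ?S" "p \<in> F" using F0 p by (auto simp: F_def)
  have tail: "(\<Sum>\<^sub>\<infinity>l\<in>?S - F. cmod (\<rho> l)) \<le> \<epsilon> / 2"
  proof -
    have "(\<Sum>\<^sub>\<infinity>l\<in>?S - F. cmod (\<rho> l)) = (\<Sum>\<^sub>\<infinity>l\<in>?S. cmod (\<rho> l)) - (\<Sum>l\<in>F. cmod (\<rho> l))"
      using F by (subst infsum_Diff[OF sum]) (auto intro: summable_on_finite)
    moreover have "(\<Sum>l\<in>F0. cmod (\<rho> l)) \<le> (\<Sum>l\<in>F. cmod (\<rho> l))"
      by (rule sum_mono2) (use F0 in \<open>auto simp: F_def\<close>)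
    ultimately show ?thesis using F0(3) unfolding dist_real_def by linarith
  qed
  obtain d where d: "d > 0" "\<And>l. l \<in> F \<Longrightarrow> l \<noteq> p \<Longrightarrow> d \<le> dist p l"
    using finite_set_avoid[OF F(1)] by blast
  define M where "M = (\<Sum>l\<in>F - {p}. cmod (\<rho> l))"
  have M: "M \<ge> 0" by (auto simp: M_def intro: sum_nonneg)
  \<comment> \<open>The first bound keeps z within d/2 of p, hence at least d/2 from the rest of F.
    The second makes their total 2M/d at most \<epsilon>/(2\<eta>); M + 1 excludes a zero
    denominator.\<close>
  define \<delta> where "\<delta> = min (d / (2 * C)) (\<epsilon> * d / (4 * (M + 1)))"
  show thesis
  proof
    show "\<delta> > 0" using d \<open>C > 0\<close> \<open>\<epsilon> > 0\<close> M by (auto simp: \<delta>_def)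
    fix \<eta> z assume \<eta>: "0 < \<eta>" "\<eta> < \<delta>" and z: "norm z \<le> 1 - \<eta>" "norm (z - p) \<le> C * \<eta>"
    let ?t = "\<lambda>l. \<rho> l / (z - l)"
    have bnd: "norm (?t l) \<le> cmod (\<rho> l) / \<eta>" if "l \<in> ?S" for l
      using norm_PSP_term_le[OF that z(1), of "\<rho> l"] \<eta> by simp
    have sum\<eta>: "(\<lambda>l. cmod (\<rho> l) / \<eta>) summable_on ?S"
      unfolding divide_inverse by (rule summable_on_cmult_left[OF sum])
    have abs: "(\<lambda>l. norm (?t l)) summable_on ?S"
      by (rule Infinite_Sum.abs_summable_on_comparison_test'[OF sum\<eta> bnd])
    have absT: "(\<lambda>l. norm (?t l)) summable_on (?S - F)" 
      by (rule summable_on_subset_banach[OF abs]) auto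
    have "norm (infsum ?t (?S - F)) \<le> (\<Sum>\<^sub>\<infinity>l\<in>?S - F. norm (?t l))"
      by (rule norm_infsum_bound[OF absT])
    also have "\<dots> \<le> (\<Sum>\<^sub>\<infinity>l\<in>?S - F. cmod (\<rho> l) / \<eta>)"
      by (rule infsum_mono[OF absT]) (use bnd in \<open>auto intro: summable_on_subset_banach[OF sum\<eta>]\<close>)
    also have "\<dots> = (\<Sum>\<^sub>\<infinity>l\<in>?S - F. cmod (\<rho> l)) / \<eta>"
      using infsum_cmult_left'[of "\<lambda>l. cmod (\<rho> l)" "1 / \<eta>" "?S - F"] by simp
    also have "\<dots> \<le> \<epsilon> / 2 / \<eta>" using tail \<eta> by (intro divide_right_mono) auto
    finally have T: "norm (infsum ?t (?S - F)) \<le> \<epsilon> / 2 / \<eta>" .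
    have "norm (\<Sum>l\<in>F - {p}. ?t l) \<le> (\<Sum>l\<in>F - {p}. cmod (\<rho> l) * (2 / d))"
    proof (rule sum_norm_le)
      fix l assume l: "l \<in> F - {p}"
      have "C * \<eta> \<le> d / 2"
        using \<eta>(2) \<open>C > 0\<close> by (simp add: \<delta>_def field_simps)
      moreover have "d \<le> norm (p - l)" using d(2)[of l] l by (simp add: dist_norm)
      ultimately have "d / 2 \<le> norm (z - l)"
        using z(2) norm_triangle_ineq2[of "p - l" "p - z"] by (simp add: norm_minus_commute)
      then have "cmod (\<rho> l) / norm (z - l) \<le> cmod (\<rho> l) / (d / 2)"
        using d(1) by (intro divide_left_mono) (auto intro!: mult_pos_pos)
      then show "norm (?t l) \<le> cmod (\<rho> l) * (2 / d)" by (simp add: norm_divide)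
    qed
    also have "\<dots> = M * (2 / d)" by (simp only: M_def sum_distrib_right)
    also have "\<dots> \<le> \<epsilon> / 2 / \<eta>"
    proof -
      have "\<eta> * (4 * (M + 1)) \<le> \<epsilon> * d"
        using \<eta>(2) M by (simp add: \<delta>_def pos_less_divide_eq)
      moreover have "\<eta> * (4 * M) \<le> \<eta> * (4 * (M + 1))" using \<eta> by simp
      ultimately have "\<eta> * (4 * M) \<le> \<epsilon> * d" by linarith
      then show ?thesis using \<eta>(1) d(1) by (simp add: field_simps)
    qed
    finally have G: "norm (\<Sum>l\<in>F - {p}. ?t l) \<le> \<epsilon> / 2 / \<eta>" .
    have "g z = infsum ?t ?S" using z \<eta> by (intro g) auto
    also have "\<dots> = infsum ?t F + infsum ?t (?S - F)"
      using infsum_Un_disjoint[of ?t F "?S - F"] F abs_summable_summable[OF absT]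
      by (simp add: Un_absorb1)
    also have "infsum ?t F = ?t p + (\<Sum>l\<in>F - {p}. ?t l)"
      using F by (simp add: sum.remove)
    finally have "g z - ?t p = (\<Sum>l\<in>F - {p}. ?t l) + infsum ?t (?S - F)" by simp
    also have "norm \<dots> \<le> \<epsilon> / 2 / \<eta> + \<epsilon> / 2 / \<eta>"
      by (rule norm_triangle_mono[OF G T])
    finally show "norm (g z - ?t p) \<le> \<epsilon> / \<eta>" by (simp add: field_simps)
  qed
qed

text \<open>Near a pole \<open>p\<close>, on an arc of length \<open>K (1 - r)\<close>, the single term \<open>\<rho> p / (z - p)\<close> carries
  half of \<open>g\<close>; its \<open>L\<^sup>1\<close> norm there is of order \<open>ln (1 + K)\<close>, and \<open>K\<close> is arbitrary.\<close>

lemma PSP_integral_lower_bound: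
  fixes \<rho> :: "complex \<Rightarrow> complex"
  assumes sum: "(\<lambda>l. cmod (\<rho> l)) summable_on sphere 0 1"
    and g: "\<And>z. z \<in> ball 0 1 \<Longrightarrow> g z = (\<Sum>\<^sub>\<infinity>l\<in>sphere 0 1. \<rho> l / (z - l))"
    and \<alpha>: "\<omega>1 < \<alpha>" "\<alpha> < \<omega>2" and nz: "\<rho> (cis \<alpha>) \<noteq> 0" and K: "K > 0"
  shows "\<exists>r\<in>{0<..<1}. ennreal (cmod (\<rho> (cis \<alpha>)) / 2 * ln (1 + K)) \<le>
    (\<integral>\<^sup>+\<omega>\<in>{\<omega>1<..<\<omega>2}. ennreal (cmod (g (of_real r * cis \<omega>))) \<partial>lborel)"
proof -
  define p where "p = cis \<alpha>"
  define c where "c = cmod (\<rho> p)"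
  have c: "c > 0" using nz by (simp add: c_def p_def)
  \<comment> \<open>Points above the arc are within (1 + K)\<eta> of p. There the pole term is at
    least c/((1 + K)\<eta>), and the tolerance is chosen as half of this.\<close>
  obtain \<delta> where \<delta>: "\<delta> > 0"
    "\<And>\<eta> z. \<lbrakk>0 < \<eta>; \<eta> < \<delta>; norm z \<le> 1 - \<eta>; norm (z - p) \<le> (1 + K) * \<eta>\<rbrakk>
       \<Longrightarrow> norm (g z - \<rho> p / (z - p)) \<le> (c / (2 * (1 + K))) / \<eta>"
    using PSP_pole_dominates[OF sum g, of p "c / (2 * (1 + K))" "1 + K"] c K
    by (auto simp: p_def)
  \<comment> \<open>The last bound keeps the arc of length K\<eta> starting at \<alpha> inside the
    given interval.\<close>
  define \<eta> where "\<eta> = min (min (\<delta> / 2) (1 / 2)) ((\<omega>2 - \<alpha>) / (2 * K))"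
  have \<eta>: "0 < \<eta>" "\<eta> < \<delta>" "\<eta> < 1" using \<delta>(1) \<alpha> K by (auto simp: \<eta>_def)
  have "\<eta> \<le> (\<omega>2 - \<alpha>) / (2 * K)" by (simp add: \<eta>_def)
  then have "K * \<eta> \<le> (\<omega>2 - \<alpha>) / 2" using K by (simp add: field_simps)
  then have K\<eta>: "\<alpha> + K * \<eta> < \<omega>2" using \<alpha> by simp
  have le: "c / 2 / (\<eta> + (\<omega> - \<alpha>)) \<le> cmod (g (of_real (1 - \<eta>) * cis \<omega>))"
    if \<omega>: "\<omega> \<in> {\<alpha>..\<alpha> + K * \<eta>}" for \<omega>
  proof -
    define z where "z = of_real (1 - \<eta>) * cis \<omega>"
    define q where "q = \<eta> + (\<omega> - \<alpha>)"
    have q: "0 < q" "q \<le> (1 + K) * \<eta>" using \<omega> \<eta> by (auto simp: q_def algebra_simps)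
    have nz: "norm z = 1 - \<eta>"
      using \<eta> by (simp only: z_def norm_mult norm_of_real norm_cis) simp
    have zw: "norm (z - cis \<omega>) = \<eta>"
    proof -
      have "z - cis \<omega> = of_real (- \<eta>) * cis \<omega>" by (simp add: z_def algebra_simps)
      then show ?thesis using \<eta> by (simp add: norm_mult del: of_real_minus)
    qed
    have "norm (z - p) \<le> norm (z - cis \<omega>) + norm (cis \<omega> - p)"
      using norm_triangle_ineq[of "z - cis \<omega>" "cis \<omega> - p"] by simp
    also have "\<dots> \<le> q" using zw norm_cis_diff_le[of \<omega> \<alpha>] \<omega> by (simp add: p_def q_def)
    finally have zp: "norm (z - p) \<le> q" .
    have "z \<noteq> p" using nz \<eta> by (auto simp: p_def)
    then have "c / q \<le> norm (\<rho> p / (z - p))"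
      using zp q c by (auto simp: c_def norm_divide intro!: divide_left_mono)
    moreover have "norm (g z - \<rho> p / (z - p)) \<le> (c / (2 * (1 + K))) / \<eta>"
      using zp q by (intro \<delta>(2) \<eta>) (auto simp: nz)
    moreover have "(c / (2 * (1 + K))) / \<eta> \<le> c / 2 / q"
    proof -
      have "c / (2 * ((1 + K) * \<eta>)) \<le> c / (2 * q)"
        using q c K \<eta> by (intro divide_left_mono) auto
      then show ?thesis by (simp only: divide_divide_eq_left mult.assoc)
    qed
    moreover have "norm (\<rho> p / (z - p)) \<le> norm (g z) + norm (g z - \<rho> p / (z - p))"
      using norm_triangle_ineq2[of "\<rho> p / (z - p)" "g z"] by (simp add: norm_minus_commute)
    ultimately have "c / q \<le> norm (g z) + c / 2 / q" by linarith
    moreover have "c / 2 / q = c / q - c / 2 / q" by (simp add: field_simps)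
    ultimately show ?thesis unfolding z_def q_def by linarith
  qed
  \<comment> \<open>The ratio of \<eta> + (\<omega> - \<alpha>) at the two ends of the arc is 1 + K,
    so the value does not depend on \<eta>.\<close>
  have "(\<integral>\<^sup>+\<omega>. ennreal (c / 2 / (\<eta> + (\<omega> - \<alpha>))) * indicator {\<alpha>..\<alpha> + K * \<eta>} \<omega> \<partial>lborel) =
      ennreal (c / 2 * ln (\<eta> + (\<alpha> + K * \<eta> - \<alpha>)) - c / 2 * ln (\<eta> + (\<alpha> - \<alpha>)))"
  proof (rule nn_integral_FTC_Icc)
    fix x assume x: "x \<in> {\<alpha>..\<alpha> + K * \<eta>}"
    have pos: "\<eta> + (x - \<alpha>) > 0" using x \<eta> by simp
    have "((\<lambda>x. \<eta> + (x - \<alpha>)) has_real_derivative 1) (at x)"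
      by (auto intro!: derivative_eq_intros)
    from DERIV_cmult[OF DERIV_chain2[OF DERIV_ln_divide[OF pos] this], of "c / 2"]
    show "((\<lambda>x. c / 2 * ln (\<eta> + (x - \<alpha>))) has_real_derivative c / 2 / (\<eta> + (x - \<alpha>))) (at x)"
      by simp
    show "0 \<le> c / 2 / (\<eta> + (x - \<alpha>))" using pos c by simp
  qed (use K \<eta> in auto)
  also have "c / 2 * ln (\<eta> + (\<alpha> + K * \<eta> - \<alpha>)) - c / 2 * ln (\<eta> + (\<alpha> - \<alpha>)) = c / 2 * ln (1 + K)"
  proof -
    have "ln (\<eta> + (\<alpha> + K * \<eta> - \<alpha>)) = ln (\<eta> * (1 + K))" by (simp add: algebra_simps)
    also have "\<dots> = ln \<eta> + ln (1 + K)" using \<eta> K by (simp add: ln_mult)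
    finally show ?thesis by (simp add: algebra_simps)
  qed
  finally have "ennreal (c / 2 * ln (1 + K)) =
      (\<integral>\<^sup>+\<omega>. ennreal (c / 2 / (\<eta> + (\<omega> - \<alpha>))) * indicator {\<alpha>..\<alpha> + K * \<eta>} \<omega> \<partial>lborel)" ..
  also have "\<dots> \<le> (\<integral>\<^sup>+\<omega>\<in>{\<omega>1<..<\<omega>2}. ennreal (cmod (g (of_real (1 - \<eta>) * cis \<omega>))) \<partial>lborel)"
    using le \<alpha>(1) K\<eta> by (intro nn_integral_mono) (auto simp: indicator_def ennreal_leI)
  finally show ?thesis
    using \<eta> by (intro bexI[of _ "1 - \<eta>"]) (auto simp: c_def p_def)
qed

lemma ennreal_eq_infinityI:
  fixes y :: ennreal
  assumes "\<And>x. x > 0 \<Longrightarrow> ennreal x \<le> y"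
  shows "y = \<infinity>"
proof (cases y rule: ennreal_cases)
  case (real r)
  with assms[of "r + 1"] show ?thesis by simp
qed simp

lemma PSP_strong_natural_boundary:
  fixes \<rho> :: "complex \<Rightarrow> complex"
  assumes hol: "g holomorphic_on ball 0 1"
    and sum: "(\<lambda>l. cmod (\<rho> l)) summable_on sphere 0 1"
    and g: "\<And>z. z \<in> ball 0 1 \<Longrightarrow> g z = (\<Sum>\<^sub>\<infinity>l\<in>sphere 0 1. \<rho> l / (z - l))"
    and dense: "\<And>\<omega>1 \<omega>2 :: real. \<omega>1 < \<omega>2 \<Longrightarrow> \<exists>\<alpha>\<in>{\<omega>1<..<\<omega>2}. \<rho> (cis \<alpha>) \<noteq> 0"
  shows "strong_natural_boundary g"
  unfolding strong_natural_boundary_def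
proof (intro conjI allI impI hol)
  fix \<omega>1 \<omega>2 :: real assume "\<omega>1 < \<omega>2"
  from dense[OF this] obtain \<alpha> where \<alpha>: "\<omega>1 < \<alpha>" "\<alpha> < \<omega>2" "\<rho> (cis \<alpha>) \<noteq> 0"
    by auto
  define c where "c = cmod (\<rho> (cis \<alpha>)) / 2"
  have c: "c > 0" using \<alpha>(3) by (simp add: c_def)
  let ?I = "SUP r\<in>{0<..<1::real}. \<integral>\<^sup>+\<omega>\<in>{\<omega>1<..<\<omega>2}. ennreal (cmod (g (of_real r * cis \<omega>))) \<partial>lborel"
  have "ennreal x \<le> ?I" if "x > 0" for x
  proof -
    \<comment> \<open>This is the K that solves c ln(1 + K) = x.\<close>
    have "exp (x / c) - 1 > 0" using that c by simp
    from PSP_integral_lower_bound[OF sum g \<alpha> this]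
    obtain r where r: "r \<in> {0<..<1}" "ennreal (c * ln (1 + (exp (x / c) - 1))) \<le>
        (\<integral>\<^sup>+\<omega>\<in>{\<omega>1<..<\<omega>2}. ennreal (cmod (g (of_real r * cis \<omega>))) \<partial>lborel)"
      unfolding c_def by blast
    have "ennreal x = ennreal (c * ln (1 + (exp (x / c) - 1)))" using c by simp
    also note r(2)
    also have "(\<integral>\<^sup>+\<omega>\<in>{\<omega>1<..<\<omega>2}. ennreal (cmod (g (of_real r * cis \<omega>))) \<partial>lborel) \<le> ?I"
      using r(1) by (rule SUP_upper)
    finally show ?thesis .
  qed
  then show "?I = \<infinity>" by (rule ennreal_eq_infinityI)
qed

section \<open>Partial fractions\<close>

text \<open>A coincidence would make (n - m)\<theta> an integer. Hence different frequencies yield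
  different poles and their residues cannot cancel.\<close>

lemma cis_multiples_inj:
  assumes "\<theta> \<notin> \<rat>"
  shows "inj (\<lambda>m::int. cis (- (2 * pi * of_int m * \<theta>)))"
proof (rule injI)
  fix m n :: int
  assume "cis (- (2 * pi * of_int m * \<theta>)) = cis (- (2 * pi * of_int n * \<theta>))"
  moreover have "cis (2 * pi * (of_int (n - m) * \<theta>)) =
      cis (- (2 * pi * of_int m * \<theta>)) / cis (- (2 * pi * of_int n * \<theta>))"
    unfolding cis_divide by (simp add: algebra_simps)
  ultimately have "cis (2 * pi * (of_int (n - m) * \<theta>)) = 1" by simp
  then have "cos (2 * pi * (of_int (n - m) * \<theta>)) = 1"
    by (simp add: complex_eq_iff)
  then obtain k :: int where "2 * pi * (of_int (n - m) * \<theta>) = of_int k * 2 * pi"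
    by (auto simp: cos_one_2pi_int)
  then have k: "of_int (n - m) * \<theta> = of_int k" by simp
  show "m = n"
  proof (rule ccontr)
    assume "m \<noteq> n"
    then have "\<theta> = of_int k / of_int (n - m)" using k by (simp add: field_simps)
    with assms show False by (metis Rats_divide Rats_of_int)
  qed
qed

text \<open>The double series over frequencies m and powers n is dominated by the product of
  \<open>\<bar>dist_Z_coeff m\<bar>\<close> and the n-th power of \<open>norm z\<close>, so the
  order of summation may be exchanged. Summing over m first gives the coefficients, over n first
  geometric series.\<close>

lemma g_plus_partial_fractions:
  assumes z: "norm z < 1"
  shows "g_plus \<theta> \<gamma> z =
    (\<Sum>\<^sub>\<infinity>m. of_real (dist_Z_coeff m) * cis (2 * pi * of_int m * \<gamma>) / (1 - cis (2 * pi * of_int m * \<theta>) * z))"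
proof -
  define f where "f m n = of_real (dist_Z_coeff m) * cis (2 * pi * of_int m * \<gamma>) *
      (cis (2 * pi * of_int m * \<theta>) * z) ^ n" for m :: int and n :: nat
  have geom: "((\<lambda>n. w ^ n) has_sum 1 / (1 - w)) UNIV" if "norm w < 1"
    for w :: "'a :: {real_normed_field, banach}"
    using that by (intro norm_summable_imp_has_sum geometric_sums) (simp add: norm_power summable_geometric)
  have "((\<lambda>n. f m n) has_sum (of_real (dist_Z_coeff m) * cis (2 * pi * of_int m * \<gamma>) *
      (1 / (1 - cis (2 * pi * of_int m * \<theta>) * z)))) UNIV" for m
    unfolding f_def by (intro has_sum_cmult_right geom) (simp add: norm_mult z)
  then have rows: "(\<Sum>\<^sub>\<infinity>n. f m n) = of_real (dist_Z_coeff m) * cis (2 * pi * of_int m * \<gamma>) /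
      (1 - cis (2 * pi * of_int m * \<theta>) * z)" for m
    by (simp add: infsumI)
  have cols: "(\<Sum>\<^sub>\<infinity>m. f m n) = of_real (dist_Z (\<gamma> + of_nat n * \<theta>)) * z ^ n" for n
  proof -
    have "f m n = of_real (dist_Z_coeff m) * cis (2 * pi * of_int m * (\<gamma> + of_nat n * \<theta>)) * z ^ n" for m
      unfolding f_def power_mult_distrib Complex.DeMoivre
      by (simp add: algebra_simps flip: cis_mult)
    then show ?thesis
      using has_sum_cmult_left[OF dist_Z_fourier, of "\<gamma> + of_nat n * \<theta>" "z ^ n"] by (simp add: infsumI)
  qed
  have norm_f: "norm (f m n) = \<bar>dist_Z_coeff m\<bar> * norm z ^ n" for m n
    by (simp add: f_def norm_mult norm_power)
  have "((\<lambda>n. norm (f m n)) has_sum (\<bar>dist_Z_coeff m\<bar> * (1 / (1 - norm z)))) UNIV" for m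
    unfolding norm_f using z by (intro has_sum_cmult_right geom) simp
  then have "(\<lambda>n. norm (f m n)) summable_on UNIV"
    "(\<Sum>\<^sub>\<infinity>n. norm (f m n)) = \<bar>dist_Z_coeff m\<bar> * (1 / (1 - norm z))" for m
    by (auto simp: infsumI summable_on_def)
  then have "(\<lambda>x. norm (case x of (m, n) \<Rightarrow> f m n)) summable_on (UNIV \<times> UNIV)"
    unfolding Infinite_Sum.abs_summable_on_Sigma_iff
    using summable_on_cmult_left[OF summable_dist_Z_coeff, of "1 / (1 - norm z)"] z
    by (simp add: abs_mult)
  from infsum_swap_banach[OF abs_summable_summable[OF this]]
  have "(\<Sum>\<^sub>\<infinity>m. \<Sum>\<^sub>\<infinity>n. f m n) = (\<Sum>\<^sub>\<infinity>n. \<Sum>\<^sub>\<infinity>m. f m n)" .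
  then show ?thesis
    using infsumI[OF g_plus_has_sum[OF z]] by (simp add: rows cols)
qed

lemma g_plus_residues:
  assumes "\<theta> \<notin> \<rat>"
  obtains \<rho> :: "complex \<Rightarrow> complex" where
    "(\<lambda>l. cmod (\<rho> l)) summable_on sphere 0 1"
    "\<And>z. z \<in> ball 0 1 \<Longrightarrow> g_plus \<theta> \<gamma> z = (\<Sum>\<^sub>\<infinity>l\<in>sphere 0 1. \<rho> l / (z - l))"
    "\<And>m. odd m \<Longrightarrow> \<rho> (cis (- (2 * pi * of_int m * \<theta>))) \<noteq> 0"
proof
  define \<mu> where "\<mu> m = cis (- (2 * pi * of_int m * \<theta>))" for m :: int
  have inj: "inj \<mu>" unfolding \<mu>_def[abs_def] by (rule cis_multiples_inj[OF assms])
  \<comment> \<open>With u = 1/\<mu> the identity 1/(1 - uz) = -\<mu>/(z - \<mu>) produces the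
    factor -\<mu>.\<close>
  define A where "A m = - of_real (dist_Z_coeff m) * cis (2 * pi * of_int m * \<gamma>) * \<mu> m" for m
  \<comment> \<open>Injectivity of \<open>\<mu>\<close> makes the residue at each pole well defined;
    extension by zero then covers the whole circle.\<close>
  define \<rho> where "\<rho> l = (if l \<in> range \<mu> then A (inv \<mu> l) else 0)" for l
  have \<rho>\<mu>: "\<rho> (\<mu> m) = A m" for m using inj by (simp add: \<rho>_def)
  have range: "range \<mu> \<subseteq> sphere 0 1" by (auto simp: \<mu>_def)
  have \<rho>0: "\<rho> l = 0" if "l \<notin> range \<mu>" for l using that by (simp add: \<rho>_def)
  have "(\<lambda>l. cmod (\<rho> l)) summable_on range \<mu>"
    unfolding summable_on_reindex[OF inj] o_def \<rho>\<mu>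
    using summable_dist_Z_coeff by (simp add: A_def \<mu>_def norm_mult)
  then show "(\<lambda>l. cmod (\<rho> l)) summable_on sphere 0 1"
    by (rule summable_on_cong_neutral[THEN iffD1, rotated -1]) (use range \<rho>0 in auto)
  show "\<rho> (cis (- (2 * pi * of_int m * \<theta>))) \<noteq> 0" if "odd m" for m
    using \<rho>\<mu>[of m] that by (auto simp: \<mu>_def A_def dist_Z_coeff_def)
  fix z :: complex assume z: "z \<in> ball 0 1"
  have "A m / (z - \<mu> m) = of_real (dist_Z_coeff m) * cis (2 * pi * of_int m * \<gamma>) /
      (1 - cis (2 * pi * of_int m * \<theta>) * z)" for m
  proof -
    define u where "u = cis (2 * pi * of_int m * \<theta>)"
    have u: "u \<noteq> 0" "\<mu> m = 1 / u" "norm u = 1"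
      by (auto simp: u_def \<mu>_def cis_divide[of 0, simplified] divide_inverse)
    have "u * z \<noteq> 1" using z u(3) by (metis norm_mult mult_1 norm_one less_irrefl mem_ball_0)
    moreover have "z - \<mu> m = - (1 - u * z) / u" using u by (simp add: field_simps)
    ultimately show ?thesis using u(1) unfolding A_def
      by (simp add: u_def[symmetric] u(2)) (metis minus_diff_eq minus_divide_right)
  qed
  then have "g_plus \<theta> \<gamma> z = (\<Sum>\<^sub>\<infinity>m. A m / (z - \<mu> m))"
    using z by (simp add: g_plus_partial_fractions)
  also have "\<dots> = (\<Sum>\<^sub>\<infinity>l\<in>range \<mu>. \<rho> l / (z - l))"
    unfolding infsum_reindex[OF inj] o_def \<rho>\<mu> ..
  also have "\<dots> = (\<Sum>\<^sub>\<infinity>l\<in>sphere 0 1. \<rho> l / (z - l))"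
    by (rule infsum_cong_neutral) (use range \<rho>0 in auto)
  finally show "g_plus \<theta> \<gamma> z = (\<Sum>\<^sub>\<infinity>l\<in>sphere 0 1. \<rho> l / (z - l))" .
qed

text \<open>Nonzero even frequencies have coefficient zero, so density is needed for odd multiples
  of \<theta> alone. It follows from the irrationality of 2\<theta>.\<close>

lemma ex_odd_multiple_in_arc:
  assumes "\<theta> \<notin> \<rat>" "\<omega>1 < \<omega>2"
  obtains m :: int and \<alpha> where "odd m" "\<alpha> \<in> {\<omega>1<..<\<omega>2}" "cis \<alpha> = cis (- (2 * pi * of_int m * \<theta>))"
proof -
  have "2 * \<theta> \<notin> \<rat>"
  proof
    assume "2 * \<theta> \<in> \<rat>"
    then have "2 * \<theta> / 2 \<in> \<rat>" by (intro Rats_divide) auto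
    with assms(1) show False by simp
  qed
  moreover have "(\<omega>2 - \<omega>1) / (4 * pi) > 0" using assms(2) by simp
  ultimately obtain h k where
    \<comment> \<open>The target is the midpoint of the arc divided by -2pi, minus \<theta> to make
      the multiple odd. The tolerance is half the arc length divided by 2pi.\<close>
    hk: "\<bar>of_int k * (2 * \<theta>) - of_int h - (- (\<omega>1 + \<omega>2) / (4 * pi) - \<theta>)\<bar> < (\<omega>2 - \<omega>1) / (4 * pi)"
    using sequence_of_fractional_parts_is_dense by metis
  define \<alpha> where "\<alpha> = 2 * pi * of_int h + - (2 * pi * of_int (2 * k + 1) * \<theta>)"
  have "2 * pi * \<bar>of_int k * (2 * \<theta>) - of_int h - (- (\<omega>1 + \<omega>2) / (4 * pi) - \<theta>)\<bar> < (\<omega>2 - \<omega>1) / 2"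
    using mult_strict_left_mono[OF hk, of "2 * pi"] by simp
  also have "2 * pi * \<bar>of_int k * (2 * \<theta>) - of_int h - (- (\<omega>1 + \<omega>2) / (4 * pi) - \<theta>)\<bar> =
      \<bar>2 * pi * (of_int k * (2 * \<theta>) - of_int h - (- (\<omega>1 + \<omega>2) / (4 * pi) - \<theta>))\<bar>"
    by (simp add: abs_mult)
  also have "2 * pi * (of_int k * (2 * \<theta>) - of_int h - (- (\<omega>1 + \<omega>2) / (4 * pi) - \<theta>)) = (\<omega>1 + \<omega>2) / 2 - \<alpha>"
    by (simp add: \<alpha>_def field_simps)
  finally have "\<alpha> \<in> {\<omega>1<..<\<omega>2}" unfolding greaterThanLessThan_iff abs_less_iff by (simp add: field_simps)
  moreover have "cis \<alpha> = cis (- (2 * pi * of_int (2 * k + 1) * \<theta>))"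
    unfolding \<alpha>_def cis_mult[symmetric] by simp
  ultimately show thesis by (intro that[of "2 * k + 1" \<alpha>]) auto
qed

theorem corollary4p7:
  fixes \<theta> \<gamma> :: real
  assumes "\<theta> \<notin> \<rat>"
  shows "(\<forall>z\<in>ball 0 1.
            summable (\<lambda>n. complex_of_real (dist_Z (\<gamma> + of_nat n * \<theta>)) * z ^ n)) \<and>
         inner_PSP_series (g_plus \<theta> \<gamma>) \<and>
         uniquely_rrl_continuable (g_plus \<theta> \<gamma>) \<and>
         rrl_continuation (g_plus \<theta> \<gamma>) (g_minus \<theta> \<gamma>) \<and>
         (\<forall>w\<in>exterior_disc.
            (\<lambda>n. complex_of_real (dist_Z (\<gamma> + of_int n * \<theta>)) * neg_power w n)
              summable_on {..<0} \<and>
            g_minus \<theta> \<gamma> w =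
              - g_plus \<theta> (- \<gamma>) (sphere_inverse w) + of_real (dist_Z \<gamma>)) \<and>
         strong_natural_boundary (g_plus \<theta> \<gamma>)"
proof (intro conjI ballI)
  obtain \<rho> :: "complex \<Rightarrow> complex" where \<rho>:
    "(\<lambda>l. cmod (\<rho> l)) summable_on sphere 0 1"
    "\<And>z. z \<in> ball 0 1 \<Longrightarrow> g_plus \<theta> \<gamma> z = (\<Sum>\<^sub>\<infinity>l\<in>sphere 0 1. \<rho> l / (z - l))"
    "\<And>m. odd m \<Longrightarrow> \<rho> (cis (- (2 * pi * of_int m * \<theta>))) \<noteq> 0"
    by (rule g_plus_residues[OF assms, where \<gamma>=\<gamma>]) blast
  show "inner_PSP_series (g_plus \<theta> \<gamma>)"
    unfolding inner_PSP_series_def using \<rho>(1,2) g_plus_holomorphic by blast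
  show "strong_natural_boundary (g_plus \<theta> \<gamma>)"
  proof (rule PSP_strong_natural_boundary[OF g_plus_holomorphic \<rho>(1,2)])
    fix \<omega>1 \<omega>2 :: real assume "\<omega>1 < \<omega>2"
    with assms obtain m :: int and \<alpha> where "odd m" "\<alpha> \<in> {\<omega>1<..<\<omega>2}"
      "cis \<alpha> = cis (- (2 * pi * of_int m * \<theta>))"
      by (rule ex_odd_multiple_in_arc)
    with \<rho>(3) show "\<exists>\<alpha>\<in>{\<omega>1<..<\<omega>2}. \<rho> (cis \<alpha>) \<noteq> 0" by metis
  qed
  show "summable (\<lambda>n. complex_of_real (dist_Z (\<gamma> + of_nat n * \<theta>)) * z ^ n)" if "z \<in> ball 0 1" for z
    using g_plus_sums[of z] that by (auto simp: sums_iff)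
  fix w assume w: "w \<in> exterior_disc"
  show "(\<lambda>n. complex_of_real (dist_Z (\<gamma> + of_int n * \<theta>)) * neg_power w n) summable_on {..<0}"
    using g_minus_has_sum[OF w] by (rule has_sum_imp_summable)
  show "g_minus \<theta> \<gamma> w = - g_plus \<theta> (- \<gamma>) (sphere_inverse w) + of_real (dist_Z \<gamma>)"
    unfolding g_minus_def infsumI[OF g_minus_has_sum[OF w]] by simp
qed (rule uniquely_rrl_continuable_g_plus rrl_continuation_g_minus assms)+

end
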